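(* For all $r\ge0$ and $0\le i\le r$, the parking triangle numbers $T(r,i)=\big|\mathcal{U}^i_{\mathrm{Car}_{r+3}}(1,1,\ldots,1)\big|$ satisfy $$T(r,i)=(r+1)^{i-1}\binom{2r-i}{r}.$$
   Context: Put $n=r+2$. The caracol graph $\mathrm{Car}_{n+1}=\mathrm{Car}_{r+3}$ is the directed graph on $\{1,\ldots,n+1\}$ with edges $(1,j)$ for $2\le j\le n$, $(i,i+1)$ for $2\le i\le n$, and $(i,n+1)$ for $2\le i\le n-1$. Its shifted out-degree vector (entries: out-degree of $i$ minus $1$, for $i=1,\ldots,n$) is $\mathbf{t}=(r,1,\ldots,1,0)$, with $|\mathbf{t}|=2r$. Its restriction $(\mathrm{Car}_{n+1})|_n$ to the vertices $1,\ldots,n$ has edges $(1,j)$, $2\le j\le n$, and $(i,i+1)$, $2\le i\le n-1$. A $\mathbf{t}$-Dyck path is a sequence of nonnegative integers $\mathbf{s}=(s_1,\ldots,s_n)$ with sum $|\mathbf{t}|$ and $\sum_{j\le k}s_j\ge\sum_{j\le k}t_j$ for all $k$, identified with the lattice path $N^{s_1}EN^{s_2}E\cdots N^{s_n}E$. Gravity diagrams: for a graph $H$ on $[n]$ (edges directed from smaller to larger vertices) and $\mathbf{v}\in\mathbb{Z}^n$ with entry sum $0$, write $\mathbf{v}=\sum_{k=1}^{n-1}d_k\boldsymbol{\alpha}_k$, $\boldsymbol{\alpha}_k=\mathbf{e}_k-\mathbf{e}_{k+1}$. A line-dot diagram is a partition of an array of dots with $d_k$ dots in column $k$ (none exists if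 some $d_k<0$) into lines, each line assigned to an edge $(p,q)$ of $H$ and consisting of exactly one dot from each of the columns $p,\ldots,q-1$. Two are equivalent if each edge is assigned the same number of lines in both. $\mathcal{GD}_H(\mathbf{v})$ is the set of equivalence classes; equivalently it is the set of ways of writing $\mathbf{v}$ as a nonnegative integer combination of the vectors $\mathbf{e}_p-\mathbf{e}_q$, $(p,q)\in E(H)$. Level-$i$ refined unified diagrams: $\mathcal{U}^i_{\mathrm{Car}_{r+3}}(1,\ldots,1)$ is the set of triples $(\mathbf{s},\sigma,D)$ where $\mathbf{s}$ is a $\mathbf{t}$-Dyck path with $s_1=|\mathbf{t}|-i$ (i.e. the first east step is $i$ levels below the top line), $\sigma$ is a permutation of $[i]$ labeling the $i$ north steps not in the first column, with labels increasing along consecutive north steps in each column, and $D\in\mathcal{GD}_{(\mathrm{Car}_{r+3})|_{r+2}}(\mathbf{s}-\mathbf{t})$. *)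

theory Defs
  imports Complex_Main "HOL-Library.FuncSet" "HOL-Library.Disjoint_Sets"
    "HOL-Combinatorics.Permutations"
begin

text \<open>
  A directed graph on the vertices 1, ..., m with edges directed from smaller to larger vertices
  is given by its edge set. Vectors of length n are functions on nat of which only the values at
  1, ..., n matter.
\<close>

type_synonym dgraph = "(nat \<times> nat) set"

text \<open>The caracol graph on m = n + 1 vertices.\<close>

definition caracol :: "nat \<Rightarrow> dgraph" where
  "caracol m =
     {(1, j) | j. 2 \<le> j \<and> j \<le> m - 1}
   \<union> {(i, i + 1) | i. 2 \<le> i \<and> i \<le> m - 1}
   \<union> {(i, m) | i. 2 \<le> i \<and> i \<le> m - 2}"

definition restrict_graph :: "dgraph \<Rightarrow> nat \<Rightarrow> dgraph" where
  "restrict_graph E n = {(p, q) \<in> E. p \<in> {1..n} \<and> q \<in> {1..n}}"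

definition shifted_outdeg :: "dgraph \<Rightarrow> nat \<Rightarrow> int" where
  "shifted_outdeg E k = int (card {q. (k, q) \<in> E}) - 1"

text \<open>
  The path is the sequence s of column heights; it is undefined outside 1, ..., n, so that
  distinct functions are distinct sequences.
\<close>

definition dyck_paths :: "nat \<Rightarrow> (nat \<Rightarrow> int) \<Rightarrow> (nat \<Rightarrow> nat) set" where
  "dyck_paths n t =
     {s \<in> {1..n} \<rightarrow>\<^sub>E UNIV.
        (\<Sum>j=1..n. int (s j)) = (\<Sum>j=1..n. t j) \<and>
        (\<forall>k\<in>{1..n}. (\<Sum>j=1..k. int (s j)) \<ge> (\<Sum>j=1..k. t j))}"

definition simple_root :: "nat \<Rightarrow> nat \<Rightarrow> int" where
  "simple_root k j = of_bool (j = k) - of_bool (j = k + 1)"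

text \<open>A dot is a pair (column, height).\<close>

definition dot_array :: "nat \<Rightarrow> (nat \<Rightarrow> int) \<Rightarrow> (nat \<times> nat) set" where
  "dot_array n d = (SIGMA k:{1..n - 1}. {1..nat (d k)})"

definition line_of_edge :: "(nat \<times> nat) set \<Rightarrow> nat \<times> nat \<Rightarrow> bool" where
  "line_of_edge l e \<longleftrightarrow> bij_betw fst l {fst e..<snd e}"

text \<open>
  A line is nonempty and its columns p, ..., q - 1 determine the edge (p, q) to which it is
  assigned, so the assignment of edges to lines need not be recorded separately.
\<close>

definition line_dot_diagrams ::
  "dgraph \<Rightarrow> nat \<Rightarrow> (nat \<Rightarrow> int) \<Rightarrow> (nat \<times> nat) set set set" where
  "line_dot_diagrams H n v =
     {P. \<exists>d. (\<forall>j\<in>{1..n}. v j = (\<Sum>k=1..n - 1. d k * simple_root k j)) \<and>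
             (\<forall>k\<in>{1..n - 1}. 0 \<le> d k) \<and>
             partition_on (dot_array n d) P \<and>
             (\<forall>l\<in>P. \<exists>e\<in>H. line_of_edge l e)}"

definition diagram_equiv ::
  "dgraph \<Rightarrow> nat \<Rightarrow> (nat \<Rightarrow> int) \<Rightarrow> ((nat \<times> nat) set set) rel" where
  "diagram_equiv H n v =
     {(P, Q). P \<in> line_dot_diagrams H n v \<and> Q \<in> line_dot_diagrams H n v \<and>
        (\<forall>e\<in>H. card {l \<in> P. line_of_edge l e} = card {l \<in> Q. line_of_edge l e})}"

definition gravity_diagrams ::
  "dgraph \<Rightarrow> nat \<Rightarrow> (nat \<Rightarrow> int) \<Rightarrow> (nat \<times> nat) set set set set" where
  "gravity_diagrams H n v = line_dot_diagrams H n v // diagram_equiv H n v"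

text \<open>
  The i north steps outside the first column are numbered 1, ..., i along the path, and
  \<open>\<sigma> k\<close> is the label of the k-th of them. Those in column j have the numbers
  from \<open>s 2 + \<dots> + s (j - 1) + 1\<close> to \<open>s 2 + \<dots> + s j\<close>.
\<close>

definition column_labelings :: "nat \<Rightarrow> nat \<Rightarrow> (nat \<Rightarrow> nat) \<Rightarrow> (nat \<Rightarrow> nat) set" where
  "column_labelings n i s =
     {\<sigma>. \<sigma> permutes {1..i} \<and>
         (\<forall>j\<in>{2..n}. strict_mono_on {(\<Sum>l=2..<j. s l)<..(\<Sum>l=2..j. s l)} \<sigma>)}"

text \<open>Level-i refined unified diagrams, at netflow (1, ..., 1), of a graph E on n + 1 vertices.\<close>

definition refined_unified_diagrams ::
  "dgraph \<Rightarrow> nat \<Rightarrow> nat \<Rightarrow>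
     ((nat \<Rightarrow> nat) \<times> (nat \<Rightarrow> nat) \<times> (nat \<times> nat) set set set) set" where
  "refined_unified_diagrams E n i =
     {(s, \<sigma>, D).
        s \<in> dyck_paths n (shifted_outdeg E) \<and>
        int (s 1) = (\<Sum>j=1..n. shifted_outdeg E j) - int i \<and>
        \<sigma> \<in> column_labelings n i s \<and>
        D \<in> gravity_diagrams (restrict_graph E n) n (\<lambda>k. int (s k) - shifted_outdeg E k)}"

definition parking_triangle :: "nat \<Rightarrow> nat \<Rightarrow> nat" where
  "parking_triangle r i = card (refined_unified_diagrams (caracol (r + 3)) (r + 2) i)"

end

theory Submission
  imports Defs "HOL-Library.Infinite_Set"
begin

text \<open>
  A permutation \<open>\<sigma>\<close> increasing on the columns amounts to a function \<open>f\<close> from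
  the labels to the \<open>r + 1\<close> columns \<open>2, \<dots>, r + 2\<close> with fibre sizes \<open>s\<close>.
  A gravity diagram of the restricted caracol graph is determined by the multiplicities \<open>c\<close> of
  the edges out of the vertex 1, a distribution of \<open>r - i\<close> indistinguishable objects to the
  same columns, because the multiplicities of the edges \<open>(k, k + 1)\<close> can be solved for. Their
  nonnegativity says that the total loads \<open>a\<^sub>j = s\<^sub>j + c\<^sub>j\<close>, which add up to
  \<open>r\<close>, satisfy \<open>a\<^sub>2 + \<dots> + a\<^sub>k \<ge> k - 1\<close> for \<open>k \<le> r + 1\<close>, and this in turn implies the Dyck
  condition. By the cycle lemma exactly one of the \<open>r + 1\<close> rotations of any load vector has
  this property, so the count is the fraction \<open>1 / (r + 1)\<close> of the number of all pairs
  \<open>(f, c)\<close>, which is \<open>(r + 1)\<^sup>i\<close> times a binomial coefficient.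
\<close>

subsection \<open>The cycle lemma\<close>

text \<open>Columns \<open>2, ..., r + 2\<close> are renumbered from 0, with
  \<open>N = r + 1\<close>. The range stops below \<open>N\<close> because the total load
  \<open>N - 1\<close> would violate the condition at \<open>k = N\<close>.\<close>

definition prefix_large :: "nat \<Rightarrow> (nat \<Rightarrow> nat) \<Rightarrow> bool" where
  "prefix_large N a \<longleftrightarrow> (\<forall>k\<in>{1..<N}. k \<le> sum a {..<k})"

definition rotation :: "nat \<Rightarrow> nat \<Rightarrow> nat \<Rightarrow> nat" where
  "rotation N t j = (if j < N then (j + t) mod N else j)"

lemma rotation_permutes: "rotation N t permutes {..<N}"
proof (rule bij_imp_permutes)
  have "inj_on (rotation N t) {..<N}"
  proof (rule inj_onI)
    fix x y assume xy: "x \<in> {..<N}" "y \<in> {..<N}" "rotation N t x = rotation N t y"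
    then have "(x + t) mod N = (y + t) mod N"
      by (simp add: rotation_def)
    then have "x mod N = y mod N"
      using nat_mod_eq_iff[of "x + t" N "y + t"] nat_mod_eq_iff[of x N y] by simp
    with xy show "x = y" by simp
  qed
  moreover have "rotation N t ` {..<N} \<subseteq> {..<N}"
    by (auto simp: rotation_def)
  ultimately show "bij_betw (rotation N t) {..<N} {..<N}"
    by (simp add: bij_betw_def endo_inj_surj)
qed (simp add: rotation_def)

text \<open>The walk with steps \<open>a j - 1\<close>, continued periodically, falls by 1 per
  period. A starting point is good iff the walk does not go below its level there during the next
  \<open>N - 1\<close> steps, and this singles out the first minimum of a period.\<close>

lemma cycle_lemma:
  assumes sum: "sum a {..<N} + 1 = N"
  shows "\<exists>!t. t < N \<and> prefix_large N (\<lambda>j. a (rotation N t j))"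
proof -
  define P where "P m = (\<Sum>j<m. int (a (j mod N)) - 1)" for m
  have N: "N > 0" using sum by simp
  have P_add: "P (t + k) = P t + (\<Sum>j<k. int (a ((j + t) mod N))) - int k" for t k
    by (induction k) (simp_all add: P_def algebra_simps)
  have "P N = int (sum a {..<N}) - int N"
    by (simp add: P_def sum_subtractf)
  then have P_N: "P N = -1"
    using sum by linarith
  have P_period: "P (m + N) = P m - 1" for m
  proof -
    have "P (N + m) = P N + P m"
      using P_add[of N m] P_add[of 0 m] by (simp add: P_def)
    then show ?thesis by (simp add: P_N add.commute)
  qed
  have good: "prefix_large N (\<lambda>j. a (rotation N t j)) \<longleftrightarrow> (\<forall>k\<in>{1..<N}. P t \<le> P (t + k))" for t
  proof -
    have "k \<le> (\<Sum>j<k. a (rotation N t j)) \<longleftrightarrow> P t \<le> P (t + k)" if "k < N" for k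
    proof -
      have "(\<Sum>j<k. a (rotation N t j)) = (\<Sum>j<k. a ((j + t) mod N))"
        using that by (intro sum.cong) (auto simp: rotation_def)
      moreover have "int (\<Sum>j<k. a ((j + t) mod N)) = P (t + k) - P t + int k"
        using P_add[of t k] by simp
      ultimately show ?thesis by linarith
    qed
    then show ?thesis by (auto simp: prefix_large_def)
  qed
  \<comment> \<open>The leftmost minimum is taken because wrapping around the period costs 1, which
    only a strict inequality to the left can absorb.\<close>
  define t where "t = (LEAST t. t < N \<and> P t = Min (P ` {..<N}))"
  have "\<exists>t. t < N \<and> P t = Min (P ` {..<N})"
    using Min_in[of "P ` {..<N}"] N by fastforce
  then have t: "t < N" "P t = Min (P ` {..<N})"
    using LeastI_ex[of "\<lambda>t. t < N \<and> P t = Min (P ` {..<N})"] by (auto simp: t_def)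
  have min: "P t \<le> P m" if "m < N" for m
    using t that by (simp add: Min_le)
  have first: "P t < P m" if "m < t" for m
  proof -
    have "P m \<noteq> P t"
      using not_less_Least[of m "\<lambda>t. t < N \<and> P t = Min (P ` {..<N})"] that t
      by (auto simp: t_def[symmetric])
    with min[of m] that t(1) show ?thesis by simp
  qed
  have t_good: "prefix_large N (\<lambda>j. a (rotation N t j))"
  proof -
    have "P t \<le> P (t + k)" if "k < N" for k
    proof (cases "t + k < N")
      case False
      then have "P (t + k) = P (t + k - N) - 1"
        using P_period[of "t + k - N"] by simp
      moreover have "t + k - N < t" using that False by simp
      ultimately show ?thesis using first[of "t + k - N"] by simp
    qed (simp add: min)
    then show ?thesis using good by simp
  qed
  \<comment> \<open>For good \<open>x < y\<close>, looking from \<open>x\<close> to \<open>y\<close>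
    and from \<open>y\<close> to \<open>x + N\<close> gives
    \<open>P x \<le> P y \<le> P (x + N) = P x - 1\<close>.\<close>
  have no: "\<not> x < y" if x: "x < N" "prefix_large N (\<lambda>j. a (rotation N x j))"
    and y: "y < N" "prefix_large N (\<lambda>j. a (rotation N y j))" for x y
  proof
    assume "x < y"
    then have "P x \<le> P y"
      using x(2) y(1) good[of x] by (auto dest!: bspec[of _ _ "y - x"])
    moreover have "P y \<le> P (x + N)"
      using bspec[OF y(2)[unfolded good], of "x + N - y"] \<open>x < y\<close> y(1)
      by (simp add: less_diff_conv Suc_le_eq)
    ultimately show False using P_period[of x] by simp
  qed
  show ?thesis
    using no t_good t(1) by (meson linorder_less_linear)
qed

subsection \<open>Pairs of functions\<close>

text \<open>Stars and bars: a function is read as the list of its values, for which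
  \<open>card_length_sum_list\<close> gives the count.\<close>

lemma card_functions_sum:
  "card {c \<in> {..<N} \<rightarrow>\<^sub>E (UNIV :: nat set). sum c {..<N} = m} = (m + N - 1) choose m"
proof -
  have "bij_betw (\<lambda>c. map c [0..<N]) {c \<in> {..<N} \<rightarrow>\<^sub>E (UNIV :: nat set). sum c {..<N} = m}
      {l. length l = N \<and> sum_list l = m}"
    by (rule bij_betw_byWitness[where f' = "\<lambda>l. \<lambda>j\<in>{..<N}. l ! j"])
      (auto simp: fun_eq_iff PiE_def extensional_def restrict_def sum_list_sum_nth
         atLeast0LessThan intro!: nth_equalityI)
  then show ?thesis
    using card_length_sum_list[of N m] bij_betw_same_card by fastforce
qed

definition function_pairs :: "nat \<Rightarrow> nat \<Rightarrow> nat \<Rightarrow> ((nat \<Rightarrow> nat) \<times> (nat \<Rightarrow> nat)) set" where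
  "function_pairs N i m =
     ({1..i} \<rightarrow>\<^sub>E {..<N}) \<times> {c \<in> {..<N} \<rightarrow>\<^sub>E UNIV. sum c {..<N} = m}"

definition pair_weight :: "nat \<Rightarrow> (nat \<Rightarrow> nat) \<times> (nat \<Rightarrow> nat) \<Rightarrow> nat \<Rightarrow> nat" where
  "pair_weight i = (\<lambda>(f, c) j. card {x \<in> {1..i}. f x = j} + c j)"

lemma finite_functions_sum: "finite {c \<in> {..<N :: nat} \<rightarrow>\<^sub>E (UNIV :: nat set). sum c {..<N} = m}"
proof (rule finite_subset)
  show "{c \<in> {..<N} \<rightarrow>\<^sub>E (UNIV :: nat set). sum c {..<N} = m} \<subseteq> {..<N} \<rightarrow>\<^sub>E {..m}"
    using member_le_sum[of _ "{..<N}"] by (fastforce simp: PiE_def Pi_def)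
qed (simp add: finite_PiE)

lemma finite_function_pairs: "finite (function_pairs N i m)"
  by (simp add: function_pairs_def finite_PiE finite_functions_sum)

lemma card_function_pairs: "card (function_pairs N i m) = N ^ i * ((m + N - 1) choose m)"
  by (simp add: function_pairs_def card_cartesian_product card_functions_sum card_PiE)

lemma sum_card_fibres:
  fixes f :: "nat \<Rightarrow> nat"
  assumes "f \<in> {1..i} \<rightarrow> {..<N}"
  shows "(\<Sum>j<N. card {x \<in> {1..i}. f x = j}) = i"
proof -
  have "(\<Sum>j<N. card {x \<in> {1..i}. f x = j}) = card (\<Union>j<N. {x \<in> {1..i}. f x = j})"
    by (subst card_UN_disjoint) auto
  also have "(\<Union>j<N. {x \<in> {1..i}. f x = j}) = {1..i}"
    using assms by auto
  finally show ?thesis by (simp only: card_atLeastAtMost)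
qed

lemma sum_pair_weight:
  assumes "x \<in> function_pairs N i m"
  shows "sum (pair_weight i x) {..<N} = i + m"
proof -
  have "fst x \<in> {1..i} \<rightarrow> {..<N}" and "sum (snd x) {..<N} = m"
    using assms by (auto simp: function_pairs_def)
  then show ?thesis
    using sum_card_fibres[of "fst x" i N] by (simp add: pair_weight_def sum.distrib split_beta)
qed

text \<open>Renaming the columns by \<open>\<pi>\<close> acts bijectively on the pairs, through
  \<open>inv \<pi>\<close> after \<open>f\<close> and through \<open>c \<circ> \<pi>\<close>, and
  turns the load at \<open>j\<close> into the load at \<open>\<pi> j\<close>.\<close>

lemma card_function_pairs_permute:
  assumes \<pi>: "\<pi> permutes {..<N}"
  shows "card {x \<in> function_pairs N i m. G (\<lambda>j. pair_weight i x (\<pi> j))}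
       = card {x \<in> function_pairs N i m. G (pair_weight i x)}"
proof -
  \<comment> \<open>\<open>\<Phi>\<close> is defined for every permutation so that
    \<open>\<Phi> (inv \<pi>)\<close> can serve as the inverse of
    \<open>\<Phi> \<pi>\<close>.\<close>
  define \<Phi> :: "(nat \<Rightarrow> nat) \<Rightarrow> (nat \<Rightarrow> nat) \<times> (nat \<Rightarrow> nat) \<Rightarrow> _"
    where "\<Phi> \<pi> = (\<lambda>(f, c). (\<lambda>x\<in>{1..i}. inv \<pi> (f x), c \<circ> \<pi>))"
    for \<pi> :: "nat \<Rightarrow> nat"
  have \<Phi>_in: "\<Phi> \<pi> x \<in> function_pairs N i m"
    if "\<pi> permutes {..<N}" "x \<in> function_pairs N i m" for \<pi> x
  proof -
    obtain f c where x: "x = (f, c)" by force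
    have "inv \<pi> (f y) < N" if "y \<in> {1..i}" for y
      using permutes_in_image[OF permutes_inv[OF \<open>\<pi> permutes {..<N}\<close>], of "f y"] that x
        \<open>x \<in> function_pairs N i m\<close> by (auto simp: function_pairs_def)
    moreover have "sum (c \<circ> \<pi>) {..<N} = sum c {..<N}"
      by (metis that(1) sum.permute)
    moreover have "c (\<pi> j) = undefined" if "\<not> j < N" for j
      using that permutes_not_in[OF \<open>\<pi> permutes {..<N}\<close>, of j] x \<open>x \<in> function_pairs N i m\<close>
      by (auto simp: function_pairs_def PiE_def extensional_def)
    ultimately show ?thesis
      using that x by (auto simp: function_pairs_def \<Phi>_def PiE_def extensional_def)
  qed
  have \<Phi>_inv: "\<Phi> (inv \<pi>) (\<Phi> \<pi> x) = x"
    if "\<pi> permutes {..<N}" "x \<in> function_pairs N i m" for \<pi> x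
    using that by (auto simp: \<Phi>_def function_pairs_def fun_eq_iff permutes_inverses
        permutes_inv_inv PiE_def extensional_def)
  have weight: "pair_weight i (\<Phi> \<pi> x) j = pair_weight i x (\<pi> j)"
    if "\<pi> permutes {..<N}" for \<pi> x j
  proof -
    obtain f c where x: "x = (f, c)" by force
    have "{y \<in> {1..i}. inv \<pi> (f y) = j} = {y \<in> {1..i}. f y = \<pi> j}"
      using permutes_inverses[OF that] by auto
    then show ?thesis
      by (simp add: x pair_weight_def \<Phi>_def restrict_def cong: conj_cong)
  qed
  have "bij_betw (\<Phi> \<pi>) {x \<in> function_pairs N i m. G (\<lambda>j. pair_weight i x (\<pi> j))}
      {x \<in> function_pairs N i m. G (pair_weight i x)}"
  proof (rule bij_betw_byWitness[where f' = "\<Phi> (inv \<pi>)"])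
    note inv = permutes_inv[OF \<pi>]
    show "\<forall>x\<in>{x \<in> function_pairs N i m. G (\<lambda>j. pair_weight i x (\<pi> j))}. \<Phi> (inv \<pi>) (\<Phi> \<pi> x) = x"
      using \<Phi>_inv[OF \<pi>] by simp
    show "\<forall>x\<in>{x \<in> function_pairs N i m. G (pair_weight i x)}. \<Phi> \<pi> (\<Phi> (inv \<pi>) x) = x"
      using \<Phi>_inv[OF inv] permutes_inv_inv[OF \<pi>] by simp
    have "(\<lambda>j. pair_weight i (\<Phi> \<pi> x) j) = (\<lambda>j. pair_weight i x (\<pi> j))" for x
      by (simp add: weight[OF \<pi>])
    then show "\<Phi> \<pi> ` {x \<in> function_pairs N i m. G (\<lambda>j. pair_weight i x (\<pi> j))}
        \<subseteq> {x \<in> function_pairs N i m. G (pair_weight i x)}"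
      using \<Phi>_in[OF \<pi>] by auto
    have "(\<lambda>j. pair_weight i (\<Phi> (inv \<pi>) x) (\<pi> j)) = pair_weight i x" for x
      by (simp add: weight[OF inv] permutes_inverses[OF \<pi>])
    then show "\<Phi> (inv \<pi>) ` {x \<in> function_pairs N i m. G (pair_weight i x)}
        \<subseteq> {x \<in> function_pairs N i m. G (\<lambda>j. pair_weight i x (\<pi> j))}"
      using \<Phi>_in[OF inv] by auto
  qed
  then show ?thesis by (rule bij_betw_same_card)
qed

text \<open>Double counting of the pairs \<open>(t, x)\<close> for which rotation \<open>t\<close>
  makes the loads of \<open>x\<close> prefix large: each \<open>x\<close> has exactly one such
  \<open>t\<close> by the cycle lemma, and each \<open>t\<close> has equally many \<open>x\<close>
  by symmetry in the columns.\<close>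

lemma card_prefix_large_pairs:
  assumes "i + m + 1 = N"
  shows "N * card {x \<in> function_pairs N i m. prefix_large N (pair_weight i x)}
       = N ^ i * ((m + N - 1) choose m)"
proof -
  let ?good = "\<lambda>t x. prefix_large N (\<lambda>j. pair_weight i x (rotation N t j))"
  have "1 * card (function_pairs N i m) = (\<Sum>t<N. card {x \<in> function_pairs N i m. ?good t x})"
  proof (rule sum_multicount[symmetric])
    show "\<forall>x\<in>function_pairs N i m. card {t \<in> {..<N}. ?good t x} = 1"
    proof
      fix x assume "x \<in> function_pairs N i m"
      then have "sum (pair_weight i x) {..<N} + 1 = N"
        using assms by (simp add: sum_pair_weight)
      from cycle_lemma[OF this] show "card {t \<in> {..<N}. ?good t x} = 1"
        by (auto simp: card_1_singleton_iff)
    qed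
  qed (auto simp: finite_function_pairs)
  also have "\<dots> = N * card {x \<in> function_pairs N i m. prefix_large N (pair_weight i x)}"
    by (simp add: card_function_pairs_permute[OF rotation_permutes, where G = "prefix_large N"])
  finally show ?thesis by (simp add: card_function_pairs)
qed

subsection \<open>Labelings\<close>

text \<open>Both values at \<open>x\<close> are elements of the common image, of the same rank there
  as \<open>x\<close> has in \<open>A\<close>.\<close>

lemma strict_mono_on_image_unique:
  fixes f g :: "'a::linorder \<Rightarrow> 'b::linorder"
  assumes A: "finite A" and f: "strict_mono_on A f" and g: "strict_mono_on A g"
    and img: "f ` A = g ` A" and x: "x \<in> A"
  shows "f x = g x"
proof -
  have rank: "card {y \<in> A. y < x} = card {z \<in> h ` A. z < h x}" if h: "strict_mono_on A h"
    for h :: "'a \<Rightarrow> 'b"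
  proof -
    have "{z \<in> h ` A. z < h x} = h ` {y \<in> A. y < x}"
      using strict_mono_on_less[OF h _ x] by auto
    moreover have "inj_on h {y \<in> A. y < x}"
      using strict_mono_on_imp_inj_on[OF h] by (rule inj_on_subset) auto
    ultimately show ?thesis by (simp add: card_image)
  qed
  have less: "card {z \<in> f ` A. z < u} < card {z \<in> f ` A. z < w}" if "u < w" "u \<in> f ` A" for u w
    using that A by (intro psubset_card_mono) auto
  have eq: "card {z \<in> f ` A. z < f x} = card {z \<in> f ` A. z < g x}"
    using rank[OF f] rank[OF g] img by simp
  show ?thesis
    using less[of "f x" "g x"] less[of "g x" "f x"] eq x img by fastforce
qed

text \<open>An increasing labeling is determined by the set of labels in each column, that is, by
  the function sending a label to its column; the fibre sizes are the column heights
  \<open>w j\<close>.\<close>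

lemma card_labelings:
  fixes w :: "nat \<Rightarrow> nat"
  assumes w: "sum w {..<N} = i"
  shows "card {\<sigma>. \<sigma> permutes {1..i} \<and>
             (\<forall>j<N. strict_mono_on {sum w {..<j}<..sum w {..j}} \<sigma>)}
       = card {f \<in> {1..i} \<rightarrow>\<^sub>E {..<N}. \<forall>j<N. card {x \<in> {1..i}. f x = j} = w j}"
    (is "card ?L = card ?F")
proof -
  \<comment> \<open>\<open>B j\<close> holds the positions of the north steps in column
    \<open>j\<close>, and \<open>col p\<close> is the column of position \<open>p\<close>; taking
    the least index rules out empty columns that follow.\<close>
  define B where "B j = {sum w {..<j}<..sum w {..j}}" for j
  define col where "col p = (LEAST j. p \<le> sum w {..j})" for p
  have mono: "sum w {..j} \<le> sum w {..<k}" if "j < k" for j k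
    using that by (intro sum_mono2) auto
  have B_sub: "B j \<subseteq> {1..i}" if "j < N" for j
    using mono[OF that] w by (auto simp: B_def)
  have card_B: "card (B j) = w j" for j
    by (simp add: B_def lessThan_Suc_atMost[symmetric])
  have col_eq: "col p = j" if "p \<in> B j" for p j
    unfolding col_def
  proof (rule Least_equality)
    show "p \<le> sum w {..j}" using that by (simp add: B_def)
    fix k assume "p \<le> sum w {..k}"
    then show "j \<le> k" using mono[of k j] that by (force simp: B_def)
  qed
  have col: "col p < N" "p \<in> B (col p)" if p: "p \<in> {1..i}" for p
  proof -
    have "N > 0" using p w by (cases N) auto
    then have ex: "p \<le> sum w {..N - 1}"
      using p w by (simp add: lessThan_Suc_atMost[symmetric])
    have "col p \<le> N - 1" unfolding col_def using ex by (rule Least_le)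
    with \<open>N > 0\<close> show "col p < N" by simp
    have "p \<le> sum w {..col p}" unfolding col_def using ex by (rule LeastI)
    moreover have "sum w {..<col p} < p"
    proof (cases "col p")
      case (Suc k)
      then have "\<not> p \<le> sum w {..k}"
        using not_less_Least[of k "\<lambda>j. p \<le> sum w {..j}"] by (simp add: col_def)
      then show ?thesis by (simp add: Suc lessThan_Suc_atMost)
    qed (use p in simp)
    ultimately show "p \<in> B (col p)" by (simp add: B_def)
  qed
  \<comment> \<open>\<open>\<sigma>\<close> maps positions to labels, so the column of a label
    \<open>x\<close> is that of the position \<open>inv \<sigma> x\<close>.\<close>
  define \<Phi> where "\<Phi> \<sigma> = (\<lambda>x\<in>{1..i}. col (inv \<sigma> x))" for \<sigma>
  have fibre: "{x \<in> {1..i}. \<Phi> \<sigma> x = j} = \<sigma> ` B j" if \<sigma>: "\<sigma> permutes {1..i}" and "j < N" for \<sigma> j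
  proof (intro equalityI subsetI)
    fix x assume "x \<in> {x \<in> {1..i}. \<Phi> \<sigma> x = j}"
    then have x: "x \<in> {1..i}" "col (inv \<sigma> x) = j" by (auto simp: \<Phi>_def)
    then have "inv \<sigma> x \<in> B j"
      using col(2)[of "inv \<sigma> x"] permutes_in_image[OF permutes_inv[OF \<sigma>], of x] by auto
    then show "x \<in> \<sigma> ` B j"
      using permutes_inverses(1)[OF \<sigma>, of x] by (metis imageI)
  next
    fix x assume "x \<in> \<sigma> ` B j"
    then obtain p where "p \<in> B j" "x = \<sigma> p" by auto
    then show "x \<in> {x \<in> {1..i}. \<Phi> \<sigma> x = j}"
      using B_sub[OF \<open>j < N\<close>] permutes_in_image[OF \<sigma>, of p] col_eq[of p j]
      by (auto simp: \<Phi>_def permutes_inverses[OF \<sigma>])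
  qed
  have "bij_betw \<Phi> ?L ?F"
    unfolding bij_betw_def
  proof (intro conjI equalityI subsetI)
    show "inj_on \<Phi> ?L"
    proof (rule inj_onI)
      fix \<sigma> \<tau> assume \<sigma>: "\<sigma> \<in> ?L" and \<tau>: "\<tau> \<in> ?L" and eq: "\<Phi> \<sigma> = \<Phi> \<tau>"
      \<comment> \<open>Equal images under \<open>\<Phi>\<close> give equal label sets on every
        block, and an increasing map on a block is determined by its image.\<close>
      have "\<sigma> p = \<tau> p" if p: "p \<in> {1..i}" for p
      proof (rule strict_mono_on_image_unique[where A = "B (col p)" and f = \<sigma> and g = \<tau> and x = p])
        show "\<sigma> ` B (col p) = \<tau> ` B (col p)"
          using fibre[of \<sigma> "col p"] fibre[of \<tau> "col p"] \<sigma> \<tau> eq col(1)[OF p] by simp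
        show "strict_mono_on (B (col p)) \<sigma>" "strict_mono_on (B (col p)) \<tau>"
          using \<sigma> \<tau> col(1)[OF p] by (auto simp: B_def)
        show "p \<in> B (col p)" by (rule col(2)[OF p])
      qed (simp add: B_def)
      moreover have "\<sigma> p = \<tau> p" if "p \<notin> {1..i}" for p
        using \<sigma> \<tau> that by (auto simp: permutes_not_in)
      ultimately show "\<sigma> = \<tau>" by blast
    qed
  next
    fix f assume "f \<in> \<Phi> ` ?L"
    then obtain \<sigma> where \<sigma>: "\<sigma> permutes {1..i}" "f = \<Phi> \<sigma>" by auto
    have "f x < N" if "x \<in> {1..i}" for x
      using that col(1)[of "inv \<sigma> x"] permutes_in_image[OF permutes_inv[OF \<sigma>(1)], of x]
      by (auto simp: \<sigma>(2) \<Phi>_def)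
    moreover have "card {x \<in> {1..i}. f x = j} = w j" if "j < N" for j
      using fibre[OF \<sigma>(1) that] card_B permutes_inj_on[OF \<sigma>(1)] by (simp add: \<sigma>(2) card_image)
    ultimately show "f \<in> ?F" by (auto simp: \<sigma>(2) \<Phi>_def)
  next
    fix f assume f: "f \<in> ?F"
    \<comment> \<open>Surjectivity: each block is filled with the labels of its fibre in increasing
      order, and the pieces are glued into one permutation.\<close>
    have "\<exists>h. bij_betw h (B j) {x \<in> {1..i}. f x = j} \<and> strict_mono_on (B j) h" if "j < N" for j
    proof -
      have "finite {x \<in> {1..i}. f x = j}" by simp
      then obtain g where g: "bij_betw g {..<w j} {x \<in> {1..i}. f x = j}"
        "strict_mono_on {..<w j} g"
        using f \<open>j < N\<close> by (elim ex_bij_betw_strict_mono_card) auto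
      \<comment> \<open>The first position of block \<open>j\<close> is one more than the number of
        earlier north steps, while \<open>g\<close> counts from 0.\<close>
      define sh where "sh p = p - Suc (sum w {..<j})" for p
      have "bij_betw sh (B j) {..<w j}"
        by (rule bij_betw_byWitness[where f' = "\<lambda>p. p + Suc (sum w {..<j})"])
          (auto simp: B_def sh_def lessThan_Suc_atMost[symmetric])
      then have "bij_betw (g \<circ> sh) (B j) {x \<in> {1..i}. f x = j}"
        using g(1) by (rule bij_betw_trans)
      moreover have "strict_mono_on (B j) (g \<circ> sh)"
        by (rule strict_mono_onI)
          (auto simp: B_def sh_def lessThan_Suc_atMost[symmetric] intro!: strict_mono_onD[OF g(2)])
      ultimately show ?thesis by blast
    qed
    then obtain h where h: "bij_betw (h j) (B j) {x \<in> {1..i}. f x = j}"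
      "strict_mono_on (B j) (h j)" if "j < N" for j
      by metis
    define \<sigma> where "\<sigma> p = (if p \<in> {1..i} then h (col p) p else p)" for p
    have \<sigma>: "\<sigma> p \<in> {1..i}" "f (\<sigma> p) = col p" if "p \<in> {1..i}" for p
      using bij_betwE[OF h(1)[OF col(1)[OF that]]] col(2)[OF that] that by (auto simp: \<sigma>_def)
    have "inj_on \<sigma> {1..i}"
    proof (rule inj_onI)
      fix p q assume pq: "p \<in> {1..i}" "q \<in> {1..i}" "\<sigma> p = \<sigma> q"
      then have "col p = col q" using \<sigma>(2) by metis
      then show "p = q"
        using pq col[OF pq(1)] col[OF pq(2)] bij_betw_imp_inj_on[OF h(1)[OF col(1)[OF pq(1)]]]
        by (auto simp: \<sigma>_def inj_on_def)
    qed
    then have "bij_betw \<sigma> {1..i} {1..i}"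
      using \<sigma>(1) endo_inj_surj[of "{1..i}" \<sigma>] by (simp add: bij_betw_def image_subset_iff)
    then have perm: "\<sigma> permutes {1..i}"
      by (rule bij_imp_permutes) (auto simp: \<sigma>_def)
    moreover have "strict_mono_on (B j) \<sigma>" if "j < N" for j
      using h(2)[OF that] B_sub[OF that] col_eq by (auto simp: strict_mono_on_def \<sigma>_def subset_iff)
    ultimately have "\<sigma> \<in> ?L" by (simp add: B_def)
    moreover have "\<Phi> \<sigma> = f"
    proof
      fix x show "\<Phi> \<sigma> x = f x"
      proof (cases "x \<in> {1..i}")
        case True
        then have "inv \<sigma> x \<in> {1..i}"
          using permutes_in_image[OF permutes_inv[OF perm]] by blast
        then show ?thesis
          using True \<sigma>(2)[of "inv \<sigma> x"] permutes_inverses(1)[OF perm, of x] by (simp add: \<Phi>_def)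
      next
        case False
        then show ?thesis using f by (auto simp: \<Phi>_def PiE_def extensional_def)
      qed
    qed
    ultimately show "f \<in> \<Phi> ` ?L" by blast
  qed
  then show ?thesis by (rule bij_betw_same_card)
qed

subsection \<open>Gravity diagrams as flows\<close>

text \<open>The equivalence classes are exactly the nonempty fibres of \<open>f\<close>.\<close>

lemma card_quotient_by_function:
  "card (A // {(x, y). x \<in> A \<and> y \<in> A \<and> f x = f y}) = card (f ` A)"
proof -
  have "A // {(x, y). x \<in> A \<and> y \<in> A \<and> f x = f y} = (\<lambda>b. {x \<in> A. f x = b}) ` f ` A"
    unfolding quotient_def image_image
    by (simp add: UNION_singleton_eq_range eq_commute cong: image_cong)
  moreover have "inj_on (\<lambda>b. {x \<in> A. f x = b}) (f ` A)"
    by (auto simp: inj_on_def)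
  ultimately show ?thesis by (simp add: card_image)
qed

section \<open>Prefix sums as coordinates in the simple roots\<close>

lemma sum_simple_root:
  assumes "1 \<le> k'"
  shows "(\<Sum>j=1..k. simple_root k' j) = of_bool (k' = k)"
proof -
  have "(\<Sum>j=1..k. of_bool (j = a)) = (of_bool (1 \<le> a \<and> a \<le> k) :: int)" for a
    by (simp add: of_bool_def)
  then show ?thesis using assms by (auto simp: simple_root_def sum_subtractf)
qed

text \<open>Prefix sums of a combination of simple roots telescope to its coefficients, and a vector
  is determined by its prefix sums; the zero total settles the last one.\<close>

lemma simple_root_expansion_iff:
  assumes v: "sum v {1..n} = 0"
  shows "(\<forall>j\<in>{1..n}. v j = (\<Sum>k=1..n - 1. d k * simple_root k j))
     \<longleftrightarrow> (\<forall>k\<in>{1..n - 1}. d k = sum v {1..k})" (is "?L \<longleftrightarrow> ?R")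
proof -
  define u where "u j = (\<Sum>k=1..n - 1. d k * simple_root k j)" for j
  have sum_u: "sum u {1..k} = (if k \<in> {1..n - 1} then d k else 0)" for k
  proof -
    have "sum u {1..k} = (\<Sum>k'=1..n - 1. \<Sum>j=1..k. d k' * simple_root k' j)"
      unfolding u_def by (rule sum.swap)
    also have "\<dots> = (\<Sum>k'=1..n - 1. d k' * (\<Sum>j=1..k. simple_root k' j))"
      by (simp add: sum_distrib_left)
    also have "\<dots> = (\<Sum>k'=1..n - 1. d k' * of_bool (k' = k))"
      using sum_simple_root by (intro sum.cong) auto
    finally show ?thesis by (simp add: of_bool_def if_distrib cong: if_cong)
  qed
  have step: "w j = sum w {1..j} - sum w {1..j - 1}" if "1 \<le> j" for w :: "nat \<Rightarrow> int" and j
    using that by (cases j) simp_all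
  show ?thesis
  proof
    assume ?L
    then have "sum v {1..k} = sum u {1..k}" if "k \<in> {1..n - 1}" for k
      using that by (intro sum.cong) (auto simp: u_def)
    with sum_u show ?R by simp
  next
    assume R: ?R
    have eq: "sum v {1..k} = sum u {1..k}" if "k \<le> n" for k
    proof (cases "k \<in> {1..n - 1}")
      case False
      with that have "k = 0 \<or> k = n" by auto
      with False v show ?thesis using sum_u[of k] by auto
    next
      case True
      then show ?thesis using sum_u[of k] R by simp
    qed
    have "v j = u j" if "j \<in> {1..n}" for j
      using step[of j v] step[of j u] eq[of j] eq[of "j - 1"] that by force
    then show ?L by (simp add: u_def)
  qed
qed

text \<open>The coefficients \<open>d\<close> are forced on the columns
  \<open>1, ..., n - 1\<close>, the only ones that \<open>dot_array\<close> and the sign condition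
  read, so the existential quantifier disappears.\<close>

lemma line_dot_diagrams_alt:
  assumes "sum v {1..n} = 0"
  shows "line_dot_diagrams H n v =
     {P. (\<forall>k\<in>{1..n - 1}. 0 \<le> sum v {1..k}) \<and>
         partition_on (dot_array n (\<lambda>k. sum v {1..k})) P \<and>
         (\<forall>l\<in>P. \<exists>e\<in>H. line_of_edge l e)}"
proof -
  define V where "V k = sum v {1..k}" for k
  define A where "A d \<longleftrightarrow> (\<forall>k\<in>{1..n - 1}. d k = V k)" for d
  have dots: "dot_array n d = dot_array n V" if "A d" for d
    unfolding dot_array_def using that by (intro Sigma_cong) (auto simp: A_def)
  have "(\<exists>d. A d \<and> (\<forall>k\<in>{1..n - 1}. 0 \<le> d k) \<and> partition_on (dot_array n d) P \<and> Q)
      \<longleftrightarrow> (\<forall>k\<in>{1..n - 1}. 0 \<le> V k) \<and> partition_on (dot_array n V) P \<and> Q" for P Q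
  proof
    assume "\<exists>d. A d \<and> (\<forall>k\<in>{1..n - 1}. 0 \<le> d k) \<and> partition_on (dot_array n d) P \<and> Q"
    then obtain d where d: "A d" "\<forall>k\<in>{1..n - 1}. 0 \<le> d k" "partition_on (dot_array n d) P" Q
      by blast
    then show "(\<forall>k\<in>{1..n - 1}. 0 \<le> V k) \<and> partition_on (dot_array n V) P \<and> Q"
      unfolding dots[OF d(1)] by (simp add: A_def)
  qed (auto simp: A_def)
  then show ?thesis
    unfolding line_dot_diagrams_def simple_root_expansion_iff[OF assms]
      V_def[symmetric] A_def[symmetric] by simp
qed

section \<open>Edge multiplicities of line-dot diagrams\<close>

lemma line_of_edge_unique:
  assumes "line_of_edge l e" "line_of_edge l e'" "fst e < snd e" "fst e' < snd e'"
  shows "e = e'"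
proof -
  have "{fst e..<snd e} = {fst e'..<snd e'}"
    using assms(1,2) by (simp add: line_of_edge_def bij_betw_def)
  then show ?thesis using assms(3,4) by (simp add: prod_eq_iff atLeastLessThan_eq_iff)
qed

text \<open>
  The ways of writing \<open>v\<close> as a nonnegative integer combination of the vectors
  \<open>e\<^sub>p - e\<^sub>q\<close> for the edges \<open>(p, q)\<close>, expressed through the coordinates with respect
  to the simple roots.
\<close>

definition flows :: "dgraph \<Rightarrow> nat \<Rightarrow> (nat \<Rightarrow> int) \<Rightarrow> (nat \<times> nat \<Rightarrow> nat) set" where
  "flows H n v = {m \<in> H \<rightarrow>\<^sub>E UNIV. \<forall>k\<in>{1..n - 1}.
     int (sum m {e \<in> H. k \<in> {fst e..<snd e}}) = sum v {1..k}}"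

text \<open>These are the invariants compared by \<open>diagram_equiv\<close>; restricting to
  \<open>H\<close> turns agreement on all edges into equality of functions.\<close>

definition line_counts :: "dgraph \<Rightarrow> (nat \<times> nat) set set \<Rightarrow> nat \<times> nat \<Rightarrow> nat" where
  "line_counts H P = (\<lambda>e\<in>H. card {l \<in> P. line_of_edge l e})"

text \<open>Double counting of the dots in column \<open>k\<close>: a line contributes one dot if
  its edge crosses the column and none otherwise.\<close>

lemma line_counts_in_flows:
  assumes H: "finite H" "\<And>e. e \<in> H \<Longrightarrow> fst e < snd e" and v: "sum v {1..n} = 0"
    and P: "P \<in> line_dot_diagrams H n v"
  shows "line_counts H P \<in> flows H n v"
proof -
  define d where "d k = sum v {1..k}" for k
  have d: "\<forall>k\<in>{1..n - 1}. 0 \<le> d k" and part: "partition_on (dot_array n d) P"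
    and lines: "\<And>l. l \<in> P \<Longrightarrow> \<exists>e\<in>H. line_of_edge l e"
    using P by (auto simp: line_dot_diagrams_alt[OF v] d_def[abs_def])
  have fin_dots: "finite (dot_array n d)" by (simp add: dot_array_def)
  have fin_P: "finite P" using finite_elements[OF fin_dots part] .
  have "int (sum (line_counts H P) {e \<in> H. k \<in> {fst e..<snd e}}) = d k" if k: "k \<in> {1..n - 1}" for k
  proof -
    let ?col = "{x \<in> dot_array n d. fst x = k}"
    let ?E = "{e \<in> H. k \<in> {fst e..<snd e}}"
    have "?col = Pair k ` {1..nat (d k)}" using k by (auto simp: dot_array_def)
    then have col_card: "int (card ?col) = d k"
      using k d by (simp add: card_image inj_on_def)
    have "card ?col = (\<Sum>l\<in>P. card {x \<in> l. fst x = k})"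
    proof -
      have "?col = (\<Union>l\<in>P. {x \<in> l. fst x = k})"
        using partition_onD1[OF part] by auto
      moreover have "{x \<in> l. fst x = k} \<inter> {x \<in> l'. fst x = k} = {}"
        if "l \<in> P" "l' \<in> P" "l \<noteq> l'" for l l'
        using disjointD[OF partition_onD2[OF part] that] by auto
      moreover have "finite l" if "l \<in> P" for l
        using partition_onD1[OF part] that fin_dots by (metis Sup_upper finite_subset)
      ultimately show ?thesis
        using fin_P by (simp add: card_UN_disjoint)
    qed
    \<comment> \<open>Since edges increase, the columns of a line determine its edge, so at most one
      summand is nonzero.\<close>
    moreover have "card {x \<in> l. fst x = k} = (\<Sum>e\<in>?E. of_bool (line_of_edge l e))" if l: "l \<in> P" for l
    proof -
      obtain e where e: "e \<in> H" "line_of_edge l e" using lines[OF l] by blast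
      have "(\<Sum>e'\<in>?E. of_bool (line_of_edge l e')) = (\<Sum>e'\<in>?E. if e' = e then 1 else (0 :: nat))"
      proof (intro sum.cong refl)
        fix e' assume "e' \<in> ?E"
        then have "line_of_edge l e' \<longleftrightarrow> e' = e"
          using line_of_edge_unique[OF _ e(2)] e H(2) by blast
        then show "of_bool (line_of_edge l e') = (if e' = e then 1 else (0 :: nat))" by simp
      qed
      also have "\<dots> = of_bool (k \<in> {fst e..<snd e})"
        using e(1) H(1) by simp
      also have "\<dots> = card {x \<in> l. fst x = k}"
      proof -
        have inj: "inj_on fst l" and img: "fst ` l = {fst e..<snd e}"
          using e(2) by (auto simp: line_of_edge_def bij_betw_def)
        show ?thesis
        proof (cases "k \<in> {fst e..<snd e}")
          case True
          then obtain x where "x \<in> l" "fst x = k" using img by (metis imageE)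
          then have "{x \<in> l. fst x = k} = {x}" using inj by (auto dest: inj_onD)
          then show ?thesis using True by simp
        next
          case False
          then have "{x \<in> l. fst x = k} = {}" using img by blast
          with False show ?thesis by (simp only: card.empty of_bool_def if_False)
        qed
      qed
      finally show ?thesis by simp
    qed
    moreover have "(\<Sum>l\<in>P. \<Sum>e\<in>?E. of_bool (line_of_edge l e)) = (\<Sum>e\<in>?E. card {l \<in> P. line_of_edge l e})"
      using fin_P by (subst sum.swap) (simp add: Int_def)
    moreover have "\<dots> = sum (line_counts H P) ?E"
      by (intro sum.cong) (auto simp: line_counts_def)
    ultimately have "card ?col = sum (line_counts H P) ?E"
      by (simp cong: sum.cong)
    with col_card show ?thesis by simp
  qed
  then show ?thesis by (auto simp: flows_def line_counts_def d_def)
qed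

text \<open>
  A flow is realised by stacking the lines crossing each column in an arbitrary order: the lines
  are indexed by \<open>L\<close>, and \<open>h k\<close> numbers those crossing column \<open>k\<close>.
\<close>

lemma flows_realised:
  assumes H: "finite H" "\<And>e. e \<in> H \<Longrightarrow> 1 \<le> fst e \<and> fst e < snd e \<and> snd e \<le> n"
    and v: "sum v {1..n} = 0" and m: "m \<in> flows H n v"
  shows "\<exists>P\<in>line_dot_diagrams H n v. line_counts H P = m"
proof -
  define d where "d k = sum v {1..k}" for k
  define L where "L = (SIGMA e:H. {..<m e})"
  define C where "C k = (SIGMA e:{e \<in> H. k \<in> {fst e..<snd e}}. {..<m e})" for k
  have card_C: "int (card (C k)) = d k" if "k \<in> {1..n - 1}" for k
    using m that H(1) by (simp add: C_def flows_def d_def)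
  have fin_C: "finite (C k)" for k using H(1) by (simp add: C_def)
  have "\<exists>h. bij_betw h (C k) {1..card (C k)}" for k
    using ex_bij_betw_finite_nat[OF fin_C[of k]] bij_betw_trans
      ex_bij_betw_nat_finite_1 fin_C bij_betw_inv by meson
  then obtain h where h: "\<And>k. bij_betw (h k) (C k) {1..card (C k)}" by metis
  \<comment> \<open>In each column that its edge crosses, the line indexed by \<open>x\<close> takes
    the dot whose height is its number there.\<close>
  define line where "line x = (\<lambda>k. (k, h k x)) ` {fst (fst x)..<snd (fst x)}" for x
  define P where "P = line ` L"
  have line_edge: "line_of_edge (line x) (fst x)" for x
    by (auto simp: line_of_edge_def line_def bij_betw_def inj_on_def image_image)
  have L_C: "x \<in> C k" if "x \<in> L" "k \<in> {fst (fst x)..<snd (fst x)}" for x k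
    using that by (auto simp: L_def C_def)
  have L_H: "fst x \<in> H" if "x \<in> L" for x using that by (auto simp: L_def)
  have disj: "x = y" if xy: "x \<in> L" "y \<in> L" "z \<in> line x" "z \<in> line y" for x y z
  proof -
    obtain k where "h k x = h k y" "x \<in> C k" "y \<in> C k"
      using xy(3,4) L_C[OF xy(1)] L_C[OF xy(2)] unfolding line_def by blast
    then show ?thesis using bij_betw_imp_inj_on[OF h[of k]] by (auto dest: inj_onD)
  qed
  have line_ne: "line x \<noteq> {}" if "x \<in> L" for x
    using H(2)[OF L_H[OF that]] by (auto simp: line_def)
  \<comment> \<open>Lines with different indices are disjoint and nonempty, hence distinct, so every
    index counts once in \<open>line_counts\<close>.\<close>
  have inj_line: "inj_on line L"
    using disj line_ne by (metis all_not_in_conv inj_onI)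
  have "partition_on (dot_array n d) P"
  proof (rule partition_onI)
    show "\<Union> P = dot_array n d"
    proof (intro equalityI subsetI)
      fix z assume "z \<in> \<Union> P"
      then obtain x k where x: "x \<in> L" "k \<in> {fst (fst x)..<snd (fst x)}" "z = (k, h k x)"
        by (auto simp: P_def line_def)
      have "k \<in> {1..n - 1}" using H(2)[OF L_H[OF x(1)]] x(2) by auto
      moreover have "h k x \<in> {1..card (C k)}" using L_C[OF x(1,2)] h bij_betwE by blast
      ultimately show "z \<in> dot_array n d"
        using card_C[of k] by (auto simp: dot_array_def x(3))
    next
      fix z assume "z \<in> dot_array n d"
      then obtain k y where z: "z = (k, y)" "k \<in> {1..n - 1}" "y \<in> {1..nat (d k)}"
        by (auto simp: dot_array_def)
      then have "y \<in> {1..card (C k)}" using card_C[of k] by auto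
      then obtain x where "x \<in> C k" "y = h k x"
        using h[of k] by (metis bij_betw_iff_bijections)
      then have "x \<in> L" "z \<in> line x"
        by (auto simp: line_def L_def C_def z(1))
      then show "z \<in> \<Union> P" by (auto simp: P_def)
    qed
    show "disjnt p q" if "p \<in> P" "q \<in> P" "p \<noteq> q" for p q
      using that disj by (fastforce simp: P_def disjnt_iff)
    show "{} \<notin> P" using line_ne by (auto simp: P_def)
  qed
  moreover have "\<forall>k\<in>{1..n - 1}. 0 \<le> d k" using card_C by (metis of_nat_0_le_iff)
  moreover have "\<forall>l\<in>P. \<exists>e\<in>H. line_of_edge l e"
    using line_edge L_H unfolding P_def by blast
  ultimately have "P \<in> line_dot_diagrams H n v"
    by (simp add: line_dot_diagrams_alt[OF v] d_def[abs_def])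
  moreover have "line_counts H P = m"
  proof
    fix e show "line_counts H P e = m e"
    proof (cases "e \<in> H")
      case True
      have "line_of_edge (line x) e \<longleftrightarrow> fst x = e" if "x \<in> L" for x
        using line_edge[of x] line_of_edge_unique[OF line_edge[of x], of e] L_H[OF that] H(2) True
        by blast
      then have "{l \<in> P. line_of_edge l e} = line ` {x \<in> L. fst x = e}"
        unfolding P_def by blast
      also have "card \<dots> = card {x \<in> L. fst x = e}"
        by (intro card_image inj_on_subset[OF inj_line]) auto
      also have "{x \<in> L. fst x = e} = Pair e ` {..<m e}"
        using True by (auto simp: L_def)
      also have "card \<dots> = m e"
        by (simp add: card_image inj_on_def)
      finally show ?thesis using True by (simp add: line_counts_def)
    next
      case False
      then show ?thesis using m by (auto simp: line_counts_def flows_def)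
    qed
  qed
  ultimately show ?thesis by blast
qed

text \<open>Equivalence of diagrams is equality of \<open>line_counts\<close>, so the classes
  correspond to the attained values, and these are all the flows.\<close>

lemma card_gravity_diagrams:
  assumes H: "finite H" "\<And>e. e \<in> H \<Longrightarrow> 1 \<le> fst e \<and> fst e < snd e \<and> snd e \<le> n"
    and v: "sum v {1..n} = 0"
  shows "card (gravity_diagrams H n v) = card (flows H n v)"
proof -
  have "diagram_equiv H n v = {(P, Q). P \<in> line_dot_diagrams H n v \<and>
      Q \<in> line_dot_diagrams H n v \<and> line_counts H P = line_counts H Q}"
    by (auto simp: diagram_equiv_def line_counts_def fun_eq_iff restrict_def)
  then have "card (gravity_diagrams H n v) = card (line_counts H ` line_dot_diagrams H n v)"
    unfolding gravity_diagrams_def by (simp add: card_quotient_by_function)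
  also have "line_counts H ` line_dot_diagrams H n v = flows H n v"
  proof (intro equalityI subsetI)
    fix m assume "m \<in> flows H n v"
    with H v have "\<exists>P\<in>line_dot_diagrams H n v. line_counts H P = m"
      by (intro flows_realised)
    then show "m \<in> line_counts H ` line_dot_diagrams H n v" by blast
  next
    have "line_counts H P \<in> flows H n v" if "P \<in> line_dot_diagrams H n v" for P
      using H v that by (intro line_counts_in_flows) auto
    then show "m \<in> flows H n v" if "m \<in> line_counts H ` line_dot_diagrams H n v" for m
      using that by blast
  qed
  finally show ?thesis .
qed

subsection \<open>The caracol graph\<close>

lemma shifted_outdeg_caracol:
  assumes "k \<in> {1..r + 2}"
  shows "shifted_outdeg (caracol (r + 3)) k = (if k = 1 then int r else if k = r + 2 then 0 else 1)"
proof -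
  have "{q. (k, q) \<in> caracol (r + 3)}
      = (if k = 1 then {2..r + 2} else if k = r + 2 then {r + 3} else {k + 1, r + 3})"
    using assms by (auto simp: caracol_def)
  then show ?thesis using assms by (auto simp: shifted_outdeg_def)
qed

lemma sum_shifted_outdeg_caracol:
  "k \<le> r \<Longrightarrow> (\<Sum>j=1..k + 1. shifted_outdeg (caracol (r + 3)) j) = int (r + k)"
  "(\<Sum>j=1..r + 2. shifted_outdeg (caracol (r + 3)) j) = int (2 * r)"
proof -
  show *: "(\<Sum>j=1..k + 1. shifted_outdeg (caracol (r + 3)) j) = int (r + k)" if "k \<le> r" for k
    using that
  proof (induction k)
    case 0
    then show ?case using shifted_outdeg_caracol[of 1 r] by simp
  next
    case (Suc k)
    then show ?case using shifted_outdeg_caracol[of "k + 2" r] by simp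
  qed
  show "(\<Sum>j=1..r + 2. shifted_outdeg (caracol (r + 3)) j) = int (2 * r)"
    using *[of r] shifted_outdeg_caracol[of "r + 2" r] by simp
qed

text \<open>The parameters match the loads: \<open>j\<close> is a column renumbered from 0, and the
  edge \<open>(k + 1, k + 2)\<close> will be governed by the load prefix of length
  \<open>k\<close>.\<close>

lemma restrict_caracol:
  "restrict_graph (caracol (r + 3)) (r + 2)
     = (\<lambda>j. (1, j + 2)) ` {..<r + 1} \<union> (\<lambda>k. (k + 1, k + 2)) ` {1..r}"
proof -
  have "(1, q) \<in> (\<lambda>j. (1, j + 2)) ` {..<r + 1}" if "2 \<le> q" "q \<le> r + 2" for q
    using that by (intro image_eqI[of _ _ "q - 2"]) auto
  moreover have "(p, p + 1) \<in> (\<lambda>k. (k + 1, k + 2)) ` {1..r}" if "2 \<le> p" "p \<le> r + 1" for p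
    using that by (intro image_eqI[of _ _ "p - 1"]) auto
  ultimately show ?thesis
    by (auto simp: restrict_graph_def caracol_def)
qed

lemma sum_column_shift:
  fixes s :: "nat \<Rightarrow> nat"
  shows "sum s {1..k + 1} = s 1 + (\<Sum>j<k. s (j + 2))"
    and "sum s {2..<k + 2} = (\<Sum>j<k. s (j + 2))"
  by (induction k) (simp_all add: numeral_2_eq_2)

section \<open>Flows on the restricted caracol graph\<close>

definition admissible_loads :: "nat \<Rightarrow> nat \<Rightarrow> (nat \<Rightarrow> nat) \<Rightarrow> (nat \<Rightarrow> nat) set" where
  "admissible_loads N m w = {c \<in> {..<N} \<rightarrow>\<^sub>E UNIV. sum c {..<N} = m \<and>
     prefix_large N (\<lambda>j. w j + c j)}"

text \<open>The first flow equation fixes the total multiplicity of the edges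
  \<open>(1, j + 2)\<close>. The equation at column \<open>k + 1\<close> then gives
  \<open>(k + 1, k + 2)\<close> the multiplicity by which the load prefix of length \<open>k\<close>
  exceeds \<open>k\<close>, and its nonnegativity is \<open>prefix_large\<close>.\<close>

lemma card_flows_caracol:
  assumes i: "i \<le> r" and s1: "s 1 = 2 * r - i"
  shows "card (flows (restrict_graph (caracol (r + 3)) (r + 2)) (r + 2)
            (\<lambda>k. int (s k) - shifted_outdeg (caracol (r + 3)) k))
       = card (admissible_loads (r + 1) (r - i) (\<lambda>j. s (j + 2)))"
proof -
  define H where "H = restrict_graph (caracol (r + 3)) (r + 2)"
  define v where "v k = int (s k) - shifted_outdeg (caracol (r + 3)) k" for k
  define w where "w j = s (j + 2)" for j
  have H: "H = (\<lambda>j. (1, j + 2)) ` {..<r + 1} \<union> (\<lambda>k. (k + 1, k + 2)) ` {1..r}"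
    unfolding H_def by (rule restrict_caracol)
  \<comment> \<open>The first \<open>k + 1\<close> shifted out-degrees sum to \<open>r + k\<close>
    and the first column has height \<open>2 * r - i\<close>, which leaves \<open>r - i - k\<close>
    besides the prefix of \<open>w\<close>.\<close>
  have sum_v: "sum v {1..k + 1} = int (r - i + sum w {..<k}) - int k" if "k \<le> r" for k
  proof -
    have "sum v {1..k + 1} = int (sum s {1..k + 1}) - int (r + k)"
      using sum_shifted_outdeg_caracol(1)[OF that] by (simp add: v_def sum_subtractf)
    moreover have "sum s {1..k + 1} = 2 * r - i + sum w {..<k}"
      unfolding sum_column_shift(1) s1 w_def ..
    ultimately show ?thesis using i by linarith
  qed
  \<comment> \<open>Column \<open>k + 1\<close> is crossed by \<open>(1, j + 2)\<close> for
    \<open>j \<ge> k\<close>. At \<open>k = 0\<close> the edge \<open>(k + 1, k + 2)\<close> is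
    already among these, hence the case distinction.\<close>
  have crossing: "sum m {e \<in> H. k + 1 \<in> {fst e..<snd e}} =
      (\<Sum>j=k..<r + 1. m (1, j + 2)) + (if k = 0 then 0 else m (k + 1, k + 2))" if "k \<le> r"
    for m :: "nat \<times> nat \<Rightarrow> nat" and k
  proof -
    have "{e \<in> H. k + 1 \<in> {fst e..<snd e}} =
        (\<lambda>j. (1, j + 2)) ` {k..<r + 1} \<union> (if k = 0 then {} else {(k + 1, k + 2)})"
      using that by (auto simp: H)
    also have "sum m \<dots> = sum m ((\<lambda>j. (1, j + 2)) ` {k..<r + 1})
        + sum m (if k = 0 then {} else {(k + 1, k + 2)})"
      by (rule sum.union_disjoint) auto
    also have "sum m ((\<lambda>j. (1, j + 2)) ` {k..<r + 1}) = (\<Sum>j=k..<r + 1. m (1, j + 2))"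
      by (subst sum.reindex) (auto simp: inj_on_def)
    finally show ?thesis by simp
  qed
  have split: "sum c {..<r + 1} = sum c {..<k} + sum c {k..<r + 1}" if "k \<le> r"
    for c :: "nat \<Rightarrow> nat" and k
    using that sum.atLeastLessThan_concat[of 0 k "r + 1" c] by (simp add: lessThan_atLeast0)
  have flow_iff: "m \<in> flows H (r + 2) v \<longleftrightarrow> m \<in> H \<rightarrow>\<^sub>E UNIV \<and> (\<Sum>j<r + 1. m (1, j + 2)) = r - i \<and>
      (\<forall>k\<in>{1..r}. m (k + 1, k + 2) + k = (\<Sum>j<k. w j + m (1, j + 2)))" (is "_ \<longleftrightarrow> ?R")
    for m
  proof -
    have "{1..r + 2 - 1} = (\<lambda>k. k + 1) ` {..r}"
      by (auto simp: image_iff Bex_def) presburger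
    then have "m \<in> flows H (r + 2) v \<longleftrightarrow> m \<in> H \<rightarrow>\<^sub>E UNIV \<and>
        (\<forall>k\<in>{..r}. int (sum m {e \<in> H. k + 1 \<in> {fst e..<snd e}}) = sum v {1..k + 1})"
      by (simp add: flows_def)
    also have "\<dots> \<longleftrightarrow> m \<in> H \<rightarrow>\<^sub>E UNIV \<and> (\<forall>k\<in>{..r}.
        (\<Sum>j=k..<r + 1. m (1, j + 2)) + (if k = 0 then 0 else m (k + 1, k + 2)) + k
        = r - i + sum w {..<k})"
    proof (intro conj_cong refl ball_cong)
      fix k assume "k \<in> {..r}"
      then have k: "k \<le> r" by simp
      show "(int (sum m {e \<in> H. k + 1 \<in> {fst e..<snd e}}) = sum v {1..k + 1}) \<longleftrightarrow>
        ((\<Sum>j=k..<r + 1. m (1, j + 2)) + (if k = 0 then 0 else m (k + 1, k + 2)) + k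
        = r - i + sum w {..<k})"
        unfolding sum_v[OF k] crossing[OF k] by linarith
    qed
    also have "{..r} = insert 0 {1..r}" by auto
    also have "m \<in> H \<rightarrow>\<^sub>E UNIV \<and> (\<forall>k\<in>insert 0 {1..r}.
        (\<Sum>j=k..<r + 1. m (1, j + 2)) + (if k = 0 then 0 else m (k + 1, k + 2)) + k
        = r - i + sum w {..<k}) \<longleftrightarrow> ?R"
    proof -
      \<comment> \<open>Writing \<open>r - i\<close> as the full sum over the edges out of 1 cancels
        those with \<open>j \<ge> k\<close> and leaves the ones with \<open>j < k\<close>.\<close>
      have "(\<Sum>j=k..<r + 1. m (1, j + 2)) + (if k = 0 then 0 else m (k + 1, k + 2)) + k
          = r - i + sum w {..<k} \<longleftrightarrow> m (k + 1, k + 2) + k = (\<Sum>j<k. w j + m (1, j + 2))"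
        if "k \<in> {1..r}" "(\<Sum>j<r + 1. m (1, j + 2)) = r - i" for k
      proof -
        have "(if k = 0 then 0 else m (k + 1, k + 2)) = m (k + 1, k + 2)" and "k \<le> r"
          using that(1) by auto
        then show ?thesis
          using that(2) split[of k "\<lambda>j. m (1, j + 2)"] unfolding sum.distrib by linarith
      qed
      moreover have "(\<Sum>j=0..<r + 1. m (1, j + 2)) + 0 + 0 = r - i + sum w {..<0}
          \<longleftrightarrow> (\<Sum>j<r + 1. m (1, j + 2)) = r - i"
        unfolding atLeast0LessThan by simp
      ultimately show ?thesis
        unfolding ball_simps simp_thms if_True by (intro conj_cong ball_cong refl)
    qed
    finally show ?thesis .
  qed
  define \<Phi> where "\<Phi> m = (\<lambda>j\<in>{..<r + 1}. m (1, j + 2))" for m :: "nat \<times> nat \<Rightarrow> nat"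
  \<comment> \<open>\<open>\<Psi>\<close> restores the multiplicities solved for; the truncated
    subtraction is exact on admissible loads by \<open>prefix_large\<close>.\<close>
  define \<Psi> where "\<Psi> c = (\<lambda>e\<in>H. if fst e = 1 then c (snd e - 2)
      else (\<Sum>j<fst e - 1. w j + c j) - (fst e - 1))" for c
  have "bij_betw \<Phi> (flows H (r + 2) v) (admissible_loads (r + 1) (r - i) w)"
  proof (rule bij_betw_byWitness[where f' = \<Psi>])
    have H_cases: "(\<exists>j<r + 1. e = (1, j + 2)) \<or> (\<exists>k\<in>{1..r}. e = (k + 1, k + 2))" if "e \<in> H" for e
      using that by (auto simp: H)
    have \<Phi>_sum: "(\<Sum>j<k. w j + \<Phi> m j) = (\<Sum>j<k. w j + m (1, j + 2))" if "k \<le> r" for k m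
      using that by (intro sum.cong) (auto simp: \<Phi>_def)
    show "\<forall>m\<in>flows H (r + 2) v. \<Psi> (\<Phi> m) = m"
    proof (intro ballI ext)
      fix m e assume m: "m \<in> flows H (r + 2) v"
      show "\<Psi> (\<Phi> m) e = m e"
      proof (cases "e \<in> H")
        case True
        from H_cases[OF True] show ?thesis
        proof (elim disjE exE bexE conjE)
          fix j assume "j < r + 1" "e = (1, j + 2)"
          then show ?thesis using True by (simp add: \<Psi>_def \<Phi>_def)
        next
          fix k assume k: "k \<in> {1..r}" "e = (k + 1, k + 2)"
          then have "m (k + 1, k + 2) + k = (\<Sum>j<k. w j + m (1, j + 2))"
            using m flow_iff by blast
          then show ?thesis using True k \<Phi>_sum[of k m] by (simp add: \<Psi>_def)
        qed
      next
        case False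
        then show ?thesis using m by (auto simp: \<Psi>_def flows_def)
      qed
    qed
    have \<Psi>_1: "\<Psi> c (1, j + 2) = c j" if "j < r + 1" for c j
      using that by (auto simp: \<Psi>_def H)
    show "\<forall>c\<in>admissible_loads (r + 1) (r - i) w. \<Phi> (\<Psi> c) = c"
    proof (intro ballI ext)
      fix c j assume "c \<in> admissible_loads (r + 1) (r - i) w"
      then show "\<Phi> (\<Psi> c) j = c j"
        using \<Psi>_1[of j c] by (cases "j < r + 1")
          (auto simp: \<Phi>_def admissible_loads_def PiE_def extensional_def)
    qed
    show "\<Phi> ` flows H (r + 2) v \<subseteq> admissible_loads (r + 1) (r - i) w"
    proof (intro image_subsetI)
      fix m assume "m \<in> flows H (r + 2) v"
      then have m: "(\<Sum>j<r + 1. m (1, j + 2)) = r - i"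
        "\<And>k. k \<in> {1..r} \<Longrightarrow> m (k + 1, k + 2) + k = (\<Sum>j<k. w j + m (1, j + 2))"
        using flow_iff by blast+
      have "sum (\<Phi> m) {..<r + 1} = r - i"
        using m(1) by (simp add: \<Phi>_def)
      moreover have "k \<le> (\<Sum>j<k. w j + \<Phi> m j)" if "k \<in> {1..<r + 1}" for k
        using m(2)[of k] \<Phi>_sum[of k m] that by simp
      ultimately show "\<Phi> m \<in> admissible_loads (r + 1) (r - i) w"
        by (simp add: admissible_loads_def prefix_large_def \<Phi>_def)
    qed
    show "\<Psi> ` admissible_loads (r + 1) (r - i) w \<subseteq> flows H (r + 2) v"
    proof (intro image_subsetI)
      fix c assume "c \<in> admissible_loads (r + 1) (r - i) w"
      then have c: "sum c {..<r + 1} = r - i" "\<And>k. k \<in> {1..r} \<Longrightarrow> k \<le> (\<Sum>j<k. w j + c j)"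
        by (auto simp: admissible_loads_def prefix_large_def)
      have "(\<Sum>j<r + 1. \<Psi> c (1, j + 2)) = r - i"
        using c(1) \<Psi>_1 by (metis (no_types, lifting) lessThan_iff sum.cong)
      moreover have "\<Psi> c (k + 1, k + 2) + k = (\<Sum>j<k. w j + \<Psi> c (1, j + 2))" if k: "k \<in> {1..r}" for k
      proof -
        have "(k + 1, k + 2) \<in> H" using k by (auto simp: H)
        then have "\<Psi> c (k + 1, k + 2) + k = (\<Sum>j<k. w j + c j)"
          using c(2)[OF k] k by (simp add: \<Psi>_def)
        also have "\<dots> = (\<Sum>j<k. w j + \<Psi> c (1, j + 2))"
          using k \<Psi>_1 by (intro sum.cong) auto
        finally show ?thesis .
      qed
      moreover have "\<Psi> c \<in> H \<rightarrow>\<^sub>E UNIV" by (simp add: \<Psi>_def)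
      ultimately show "\<Psi> c \<in> flows H (r + 2) v" using flow_iff by blast
    qed
  qed
  then show ?thesis
    using bij_betw_same_card by (fastforce simp: H_def v_def[abs_def] w_def[abs_def])
qed

lemma prefix_large_cong:
  assumes "\<And>j. j < N \<Longrightarrow> a j = b j"
  shows "prefix_large N a \<longleftrightarrow> prefix_large N b"
proof -
  have "sum a {..<k} = sum b {..<k}" if "k \<in> {1..<N}" for k
    using assms that by (intro sum.cong) auto
  then show ?thesis by (simp add: prefix_large_def)
qed

section \<open>Labelings as functions, and finiteness\<close>

definition functions_with_fibres :: "nat \<Rightarrow> nat \<Rightarrow> (nat \<Rightarrow> nat) \<Rightarrow> (nat \<Rightarrow> nat) set" where
  "functions_with_fibres N i w =
     {f \<in> {1..i} \<rightarrow>\<^sub>E {..<N}. \<forall>j<N. card {x \<in> {1..i}. f x = j} = w j}"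

lemma card_column_labelings:
  assumes "(\<Sum>j<r + 1. s (j + 2)) = i"
  shows "card (column_labelings (r + 2) i s) = card (functions_with_fibres (r + 1) i (\<lambda>j. s (j + 2)))"
proof -
  have cols: "{2..r + 2} = (\<lambda>j. j + 2) ` {..<r + 1}"
    by (auto simp: image_iff Bex_def) presburger
  have blocks: "sum s {2..j + 2} = (\<Sum>l\<le>j. s (l + 2))" for j
    using sum_column_shift(2)[of s "j + 1"]
    by (simp add: lessThan_Suc_atMost atLeastLessThanSuc_atLeastAtMost)
  have "column_labelings (r + 2) i s = {\<sigma>. \<sigma> permutes {1..i} \<and>
      (\<forall>j<r + 1. strict_mono_on {\<Sum>l<j. s (l + 2)<..\<Sum>l\<le>j. s (l + 2)} \<sigma>)}"
    unfolding column_labelings_def cols ball_simps sum_column_shift(2) blocks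
    by (simp only: Ball_def lessThan_iff)
  then show ?thesis
    using card_labelings[OF assms] by (simp add: functions_with_fibres_def)
qed

lemma finite_gravity_diagrams:
  assumes "sum v {1..n} = 0"
  shows "finite (gravity_diagrams H n v)"
proof -
  have "line_dot_diagrams H n v \<subseteq> Pow (Pow (dot_array n (\<lambda>k. sum v {1..k})))"
    unfolding line_dot_diagrams_alt[OF assms] by (auto dest: partition_onD1)
  then have "finite (line_dot_diagrams H n v)"
    by (rule finite_subset) (simp add: dot_array_def)
  then show ?thesis
    unfolding gravity_diagrams_def by (rule finite_quotient) (auto simp: diagram_equiv_def)
qed

lemma finite_admissible_loads: "finite (admissible_loads N m w)"
  using finite_functions_sum[of N m] by (rule finite_subset[rotated]) (auto simp: admissible_loads_def)

lemma finite_functions_with_fibres: "finite (functions_with_fibres N i w)"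
  by (rule finite_subset[of _ "{1..i} \<rightarrow>\<^sub>E {..<N}"]) (auto simp: functions_with_fibres_def finite_PiE)

section \<open>Dyck paths at a fixed level\<close>

definition level_paths :: "nat \<Rightarrow> nat \<Rightarrow> (nat \<Rightarrow> nat) set" where
  "level_paths r i = {s \<in> dyck_paths (r + 2) (shifted_outdeg (caracol (r + 3))).
     int (s 1) = (\<Sum>j=1..r + 2. shifted_outdeg (caracol (r + 3)) j) - int i}"

text \<open>Inserting \<open>s 1 = 2 * r - i\<close> turns the Dyck condition into one on the
  renumbered columns that can be compared with \<open>prefix_large\<close>: \<open>r - i\<close>
  stands where the prefix of \<open>c\<close> stands there.\<close>

lemma level_paths_iff:
  assumes "i \<le> r"
  shows "s \<in> level_paths r i \<longleftrightarrow> s \<in> {1..r + 2} \<rightarrow>\<^sub>E UNIV \<and> s 1 = 2 * r - i \<and>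
    (\<Sum>j<r + 1. s (j + 2)) = i \<and> (\<forall>k\<in>{1..<r + 1}. k \<le> r - i + (\<Sum>j<k. s (j + 2)))"
proof -
  let ?t = "shifted_outdeg (caracol (r + 3))"
  \<comment> \<open>The prefix of length \<open>r + 2\<close> is split off, since its condition
    follows from the equality of the totals.\<close>
  have cols: "{1..r + 2} = insert (r + 2) ((\<lambda>k. k + 1) ` {..r})"
    by (auto simp: image_iff Bex_def) presburger
  have "s \<in> level_paths r i \<longleftrightarrow> s \<in> {1..r + 2} \<rightarrow>\<^sub>E UNIV \<and> int (s 1) = int (2 * r) - int i \<and>
      int (sum s {1..r + 2}) = int (2 * r) \<and>
      (\<forall>k\<in>{1..r + 2}. sum ?t {1..k} \<le> int (sum s {1..k}))"
    unfolding level_paths_def dyck_paths_def sum_shifted_outdeg_caracol(2) of_nat_sum by blast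
  also have "\<dots> \<longleftrightarrow> s \<in> {1..r + 2} \<rightarrow>\<^sub>E UNIV \<and> int (s 1) = int (2 * r) - int i \<and>
      int (sum s {1..r + 2}) = int (2 * r) \<and>
      (\<forall>k\<le>r. sum ?t {1..k + 1} \<le> int (sum s {1..k + 1}))"
  proof (intro conj_cong refl)
    assume "int (sum s {1..r + 2}) = int (2 * r)"
    then have "sum ?t {1..r + 2} \<le> int (sum s {1..r + 2})"
      unfolding sum_shifted_outdeg_caracol(2) by simp
    then show "(\<forall>k\<in>{1..r + 2}. sum ?t {1..k} \<le> int (sum s {1..k})) \<longleftrightarrow>
        (\<forall>k\<le>r. sum ?t {1..k + 1} \<le> int (sum s {1..k + 1}))"
      unfolding cols ball_simps by blast
  qed
  also have "\<dots> \<longleftrightarrow> s \<in> {1..r + 2} \<rightarrow>\<^sub>E UNIV \<and> s 1 = 2 * r - i \<and>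
      s 1 + (\<Sum>j<r + 1. s (j + 2)) = 2 * r \<and>
      (\<forall>k\<le>r. r + k \<le> s 1 + (\<Sum>j<k. s (j + 2)))"
  proof (intro conj_cong refl all_cong)
    show "int (s 1) = int (2 * r) - int i \<longleftrightarrow> s 1 = 2 * r - i"
      using assms by linarith
    show "int (sum s {1..r + 2}) = int (2 * r) \<longleftrightarrow> s 1 + (\<Sum>j<r + 1. s (j + 2)) = 2 * r"
    proof -
      have "r + 2 = r + 1 + 1" by simp
      then have "sum s {1..r + 2} = s 1 + (\<Sum>j<r + 1. s (j + 2))"
        by (metis sum_column_shift(1))
      then show ?thesis by linarith
    qed
    show "sum ?t {1..k + 1} \<le> int (sum s {1..k + 1}) \<longleftrightarrow> r + k \<le> s 1 + (\<Sum>j<k. s (j + 2))"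
      if "k \<le> r" for k
      using sum_shifted_outdeg_caracol(1)[OF that] sum_column_shift(1)[of s k] by linarith
  qed
  also have "\<dots> \<longleftrightarrow> s \<in> {1..r + 2} \<rightarrow>\<^sub>E UNIV \<and> s 1 = 2 * r - i \<and>
    (\<Sum>j<r + 1. s (j + 2)) = i \<and> (\<forall>k\<in>{1..<r + 1}. k \<le> r - i + (\<Sum>j<k. s (j + 2)))"
  proof (intro conj_cong refl)
    assume s1: "s 1 = 2 * r - i"
    show "s 1 + (\<Sum>j<r + 1. s (j + 2)) = 2 * r \<longleftrightarrow> (\<Sum>j<r + 1. s (j + 2)) = i"
      unfolding s1 using assms by linarith
    have "r + k \<le> s 1 + (\<Sum>j<k. s (j + 2)) \<longleftrightarrow> k \<le> r - i + (\<Sum>j<k. s (j + 2))" for k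
      unfolding s1 using assms by linarith
    then show "(\<forall>k\<le>r. r + k \<le> s 1 + (\<Sum>j<k. s (j + 2))) \<longleftrightarrow>
        (\<forall>k\<in>{1..<r + 1}. k \<le> r - i + (\<Sum>j<k. s (j + 2)))"
      by (auto simp: less_Suc_eq_le)
  qed
  finally show ?thesis .
qed

lemma finite_level_paths:
  assumes "i \<le> r"
  shows "finite (level_paths r i)"
proof (rule finite_subset)
  show "level_paths r i \<subseteq> {1..r + 2} \<rightarrow>\<^sub>E {..2 * r}"
  proof
    fix s assume s: "s \<in> level_paths r i"
    then have "int (sum s {1..r + 2}) = int (2 * r)"
      by (simp add: level_paths_def dyck_paths_def sum_shifted_outdeg_caracol(2)[simplified])
    then have "sum s {1..r + 2} = 2 * r" by linarith
    then have "s j \<le> 2 * r" if "j \<in> {1..r + 2}" for j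
      using member_le_sum[of j "{1..r + 2}" s] that by (metis finite_atLeastAtMost le0)
    then show "s \<in> {1..r + 2} \<rightarrow>\<^sub>E {..2 * r}"
      using s by (auto simp: level_paths_def dyck_paths_def)
  qed
qed (simp add: finite_PiE)

text \<open>The path can be forgotten, since \<open>f\<close> determines its column heights as fibre
  sizes. Conversely, the path built from a prefix-large pair is automatically Dyck.\<close>

lemma card_level_pairs:
  assumes i: "i \<le> r"
  shows "card (SIGMA s:level_paths r i. functions_with_fibres (r + 1) i (\<lambda>j. s (j + 2)) \<times>
            admissible_loads (r + 1) (r - i) (\<lambda>j. s (j + 2)))
       = card {x \<in> function_pairs (r + 1) i (r - i). prefix_large (r + 1) (pair_weight i x)}"
    (is "card ?S = card ?Q")
proof -
  have "bij_betw snd ?S ?Q"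
    unfolding bij_betw_def
  proof (intro conjI equalityI subsetI)
    show "inj_on snd ?S"
    proof (rule inj_onI)
      fix x y assume x: "x \<in> ?S" and y: "y \<in> ?S" and eq: "snd x = snd y"
      have "fst x j = fst y j" for j
      proof -
        consider "j \<notin> {1..r + 2}" | "j = 1" | j' where "j = j' + 2" "j' < r + 1"
        proof -
          have "j \<notin> {1..r + 2} \<or> j = 1 \<or> (\<exists>j'. j = j' + 2 \<and> j' < r + 1)"
            unfolding atLeastAtMost_iff by presburger
          then show ?thesis using that by blast
        qed
        then show ?thesis
        proof cases
          case 1
          then show ?thesis
            using x y level_paths_iff[OF i] by (auto simp: PiE_def extensional_def)
        next
          case 2
          then show ?thesis using x y level_paths_iff[OF i] by auto
        next
          case 3
          then show ?thesis using x y eq by (auto simp: functions_with_fibres_def)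
        qed
      qed
      with eq show "x = y" by (simp add: prod_eq_iff fun_eq_iff)
    qed
  next
    fix x assume "x \<in> snd ` ?S"
    then obtain f c s where x: "x = (f, c)" and s: "s \<in> level_paths r i"
      and f: "f \<in> functions_with_fibres (r + 1) i (\<lambda>j. s (j + 2))"
      and c: "c \<in> admissible_loads (r + 1) (r - i) (\<lambda>j. s (j + 2))"
      by auto
    have "prefix_large (r + 1) (pair_weight i x) \<longleftrightarrow> prefix_large (r + 1) (\<lambda>j. s (j + 2) + c j)"
      using f by (intro prefix_large_cong) (simp add: x pair_weight_def functions_with_fibres_def)
    then show "x \<in> ?Q"
      using f c by (simp add: x function_pairs_def functions_with_fibres_def admissible_loads_def)
  next
    fix x assume x: "x \<in> ?Q"
    obtain f c where fc: "x = (f, c)" by force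
    have f: "f \<in> {1..i} \<rightarrow>\<^sub>E {..<r + 1}" and c: "c \<in> {..<r + 1} \<rightarrow>\<^sub>E UNIV" "sum c {..<r + 1} = r - i"
      and large: "prefix_large (r + 1) (pair_weight i x)"
      using x by (auto simp: fc function_pairs_def)
    \<comment> \<open>Level \<open>i\<close> prescribes the height \<open>2 * r - i\<close> of the
      first column; the offset 2 undoes the renumbering.\<close>
    define s where "s = (\<lambda>j\<in>{1..r + 2}. if j = 1 then 2 * r - i else card {x \<in> {1..i}. f x = j - 2})"
    have s_shift: "s (j + 2) = card {x \<in> {1..i}. f x = j}" if "j < r + 1" for j
      using that by (simp add: s_def)
    have weight: "pair_weight i x j = s (j + 2) + c j" if "j < r + 1" for j
      using s_shift[OF that] by (simp add: fc pair_weight_def)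
    have large': "prefix_large (r + 1) (\<lambda>j. s (j + 2) + c j)"
      by (rule iffD1[OF prefix_large_cong[OF weight] large])
    have "(\<Sum>j<r + 1. s (j + 2)) = (\<Sum>j<r + 1. card {x \<in> {1..i}. f x = j})"
      using s_shift by (intro sum.cong) auto
    then have "(\<Sum>j<r + 1. s (j + 2)) = i"
      using sum_card_fibres[of f i "r + 1"] f by auto
    moreover have "k \<le> r - i + (\<Sum>j<k. s (j + 2))" if k: "k \<in> {1..<r + 1}" for k
    proof -
      \<comment> \<open>The share of \<open>c\<close> in the first \<open>k\<close> columns is at
        most its total \<open>r - i\<close>, which gives the Dyck condition.\<close>
      have "k \<le> (\<Sum>j<k. s (j + 2)) + sum c {..<k}"
        using large' k by (simp add: prefix_large_def sum.distrib)
      moreover have "sum c {..<k} \<le> sum c {..<r + 1}"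
        using k by (intro sum_mono2) auto
      ultimately show ?thesis using c(2) by simp
    qed
    moreover have "s \<in> {1..r + 2} \<rightarrow>\<^sub>E UNIV" "s 1 = 2 * r - i" by (auto simp: s_def)
    ultimately have "s \<in> level_paths r i"
      unfolding level_paths_iff[OF i] by blast
    moreover have "f \<in> functions_with_fibres (r + 1) i (\<lambda>j. s (j + 2))"
      using f s_shift by (simp add: functions_with_fibres_def)
    moreover have "c \<in> admissible_loads (r + 1) (r - i) (\<lambda>j. s (j + 2))"
      using c large' by (simp add: admissible_loads_def)
    ultimately have "(s, x) \<in> ?S" by (simp add: fc)
    then show "x \<in> snd ` ?S" by force
  qed
  then show ?thesis by (rule bij_betw_same_card)
qed

text \<open>For each path of level \<open>i\<close>, labelings and gravity diagrams are counted
  independently; their numbers are replaced by those of functions and distributions, and the sum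
  over paths is reassembled.\<close>

lemma parking_triangle_eq_card_pairs:
  assumes i: "i \<le> r"
  shows "parking_triangle r i
       = card {x \<in> function_pairs (r + 1) i (r - i). prefix_large (r + 1) (pair_weight i x)}"
proof -
  let ?E = "caracol (r + 3)"
  define L where "L s = column_labelings (r + 2) i s" for s
  define G where "G s = gravity_diagrams (restrict_graph ?E (r + 2)) (r + 2)
    (\<lambda>k. int (s k) - shifted_outdeg ?E k)" for s
  have sums: "(\<Sum>j<r + 1. s (j + 2)) = i" "s 1 = 2 * r - i"
    "(\<Sum>k=1..r + 2. int (s k) - shifted_outdeg ?E k) = 0" if "s \<in> level_paths r i" for s
    using that level_paths_iff[OF i, of s]
    by (auto simp: level_paths_def dyck_paths_def sum_subtractf)
  have H: "1 \<le> fst e \<and> fst e < snd e \<and> snd e \<le> r + 2" if "e \<in> restrict_graph ?E (r + 2)" for e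
    using that unfolding restrict_caracol by auto
  have fin_H: "finite (restrict_graph ?E (r + 2))"
    unfolding restrict_caracol by simp
  have "refined_unified_diagrams ?E (r + 2) i = (SIGMA s:level_paths r i. L s \<times> G s)"
    by (auto simp: refined_unified_diagrams_def level_paths_def L_def G_def)
  then have "parking_triangle r i = card (SIGMA s:level_paths r i. L s \<times> G s)"
    by (simp add: parking_triangle_def)
  also have "\<dots> = (\<Sum>s\<in>level_paths r i. card (L s) * card (G s))"
  proof -
    have "finite (L s)" for s
      unfolding L_def column_labelings_def
      by (rule finite_subset[OF _ finite_permutations[of "{1..i}"]]) auto
    moreover have "finite (G s)" if "s \<in> level_paths r i" for s
      unfolding G_def by (rule finite_gravity_diagrams[OF sums(3)[OF that]])
    ultimately show ?thesis
      using finite_level_paths[OF i] by (simp add: card_SigmaI card_cartesian_product)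
  qed
  also have "\<dots> = (\<Sum>s\<in>level_paths r i.
      card (functions_with_fibres (r + 1) i (\<lambda>j. s (j + 2))) *
      card (admissible_loads (r + 1) (r - i) (\<lambda>j. s (j + 2))))"
  proof (intro sum.cong refl arg_cong2[where f = "(*)"])
    fix s assume s: "s \<in> level_paths r i"
    show "card (L s) = card (functions_with_fibres (r + 1) i (\<lambda>j. s (j + 2)))"
      unfolding L_def by (rule card_column_labelings[OF sums(1)[OF s]])
    show "card (G s) = card (admissible_loads (r + 1) (r - i) (\<lambda>j. s (j + 2)))"
    proof -
      have "card (G s) = card (flows (restrict_graph ?E (r + 2)) (r + 2)
          (\<lambda>k. int (s k) - shifted_outdeg ?E k))"
        unfolding G_def by (rule card_gravity_diagrams[OF fin_H _ sums(3)[OF s]]) (rule H)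
      also have "\<dots> = card (admissible_loads (r + 1) (r - i) (\<lambda>j. s (j + 2)))"
        by (rule card_flows_caracol[where s = s, OF i sums(2)[OF s]])
      finally show ?thesis .
    qed
  qed
  also have "\<dots> = card (SIGMA s:level_paths r i. functions_with_fibres (r + 1) i (\<lambda>j. s (j + 2)) \<times>
      admissible_loads (r + 1) (r - i) (\<lambda>j. s (j + 2)))"
    using finite_level_paths[OF i] finite_admissible_loads finite_functions_with_fibres
    by (simp add: card_SigmaI card_cartesian_product)
  also have "\<dots> = card {x \<in> function_pairs (r + 1) i (r - i). prefix_large (r + 1) (pair_weight i x)}"
    by (rule card_level_pairs[OF i])
  finally show ?thesis .
qed

theorem theorem5p9:
  fixes r i :: nat
  assumes "i \<le> r"
  shows "real (parking_triangle r i) = real (r + 1) powi (int i - 1) * real ((2 * r - i) choose r)"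
proof -
  \<comment> \<open>Here \<open>N = r + 1\<close> and \<open>m = r - i\<close>, so that the loads
    add up to \<open>N - 1 = r\<close>.\<close>
  have "(r + 1) * parking_triangle r i = (r + 1) ^ i * ((r - i + (r + 1) - 1) choose (r - i))"
    unfolding parking_triangle_eq_card_pairs[OF assms]
    using assms by (intro card_prefix_large_pairs) simp
  also have "r - i + (r + 1) - 1 = 2 * r - i"
    using assms by simp
  also have "(2 * r - i) choose (r - i) = (2 * r - i) choose r"
    using assms binomial_symmetric[of r "2 * r - i"] by simp
  finally have "real (r + 1) * real (parking_triangle r i)
      = real (r + 1) ^ i * real ((2 * r - i) choose r)"
    by (metis of_nat_mult of_nat_power)
  \<comment> \<open>Division in the reals also covers \<open>i = 0\<close>, where the exponent is
    \<open>-1\<close>.\<close>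
  then have "real (parking_triangle r i)
      = real (r + 1) ^ i / real (r + 1) * real ((2 * r - i) choose r)"
    by (metis nonzero_mult_div_cancel_left of_nat_eq_0_iff Suc_eq_plus1 nat.simps(3)
        times_divide_eq_left)
  then show ?thesis by (simp add: power_int_diff)
qed

end
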